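(* Let $\mathcal A$ be a nonempty finite set and let $g_m>0$, $h_m\in\mathbb C\setminus\{0\}$, $P_m>0$ for $m\in\mathcal A$, and $\sigma^2>0$. Consider the problem $$\min_{\{p_m\}_{m\in\mathcal A},\,\eta}\ \sum_{m\in\mathcal A}\Big(\frac{|h_m|\sqrt{p_m}}{\eta}-g_m\Big)^2+\frac{\sigma^2}{\eta^2}\quad\text{s.t. } 0\le p_m\le P_m\ (m\in\mathcal A),\ \ \eta>0 .$$ With $\tau_{(n)}$, $\hat\eta_n^\star$, $\eta_n^\star$ ($1\le n\le|\mathcal A|$) and the function $\mathrm{MSE}(\eta)$ as defined in the context, let $$n^\star\in\arg\min_{1\le n\le|\mathcal A|}\mathrm{MSE}(\eta_n^\star).$$ Then a globally optimal denoising factor is $\eta^\star=\eta_{n^\star}^\star$, and, given $\eta^\star$, the globally optimal transmit powers are $$p_m^\star=\min\Big\{\Big(\frac{\eta^\star g_m}{|h_m|}\Big)^2,\ P_m\Big\},\qquad m\in\mathcal A;$$ that is, $(\{p_m^\star\}_{m\in\mathcal A},\eta^\star)$ attains the minimum of the problem.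
   Context: For $m\in\mathcal A$ define the saturation threshold $\tau_m=|h_m|\sqrt{P_m}/g_m$. Order the elements of $\mathcal A$ as $(1),(2),\dots,(|\mathcal A|)$ so that $\tau_{(1)}\le\tau_{(2)}\le\cdots\le\tau_{(|\mathcal A|)}$, and put $\tau_{(|\mathcal A|+1)}=+\infty$. For $1\le n\le|\mathcal A|$ define $$\hat\eta_n^\star=\frac{\sum_{j=1}^{n}|h_{(j)}|^2P_{(j)}+\sigma^2}{\sum_{j=1}^{n}|h_{(j)}|\sqrt{P_{(j)}}\,g_{(j)}},\qquad \eta_n^\star=\min\big\{\max\{\hat\eta_n^\star,\tau_{(n)}\},\tau_{(n+1)}\big\}.$$ For $\eta>0$ define the reduced objective $$\mathrm{MSE}(\eta)=\sum_{m\in\mathcal A}\max\Big\{0,\ g_m-\frac{|h_m|\sqrt{P_m}}{\eta}\Big\}^2+\frac{\sigma^2}{\eta^2}.$$ *)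

theory Defs
  imports "HOL-Analysis.Analysis"
begin

definition objective ::
  "'m set \<Rightarrow> ('m \<Rightarrow> real) \<Rightarrow> ('m \<Rightarrow> complex) \<Rightarrow> real \<Rightarrow> ('m \<Rightarrow> real) \<times> real \<Rightarrow> real" where
  "objective A g h \<sigma> = (\<lambda>(p, \<eta>).
     (\<Sum>m\<in>A. (cmod (h m) * sqrt (p m) / \<eta> - g m)\<^sup>2) + \<sigma>\<^sup>2 / \<eta>\<^sup>2)"

text \<open>A power allocation is a total function; only its values on the index set matter.\<close>

definition feasible :: "'m set \<Rightarrow> ('m \<Rightarrow> real) \<Rightarrow> ('m \<Rightarrow> real) \<times> real \<Rightarrow> bool" where
  "feasible A P = (\<lambda>(p, \<eta>). (\<forall>m\<in>A. 0 \<le> p m \<and> p m \<le> P m) \<and> 0 < \<eta>)"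

definition MSE ::
  "'m set \<Rightarrow> ('m \<Rightarrow> real) \<Rightarrow> ('m \<Rightarrow> complex) \<Rightarrow> ('m \<Rightarrow> real) \<Rightarrow> real \<Rightarrow> real \<Rightarrow> real" where
  "MSE A g h P \<sigma> \<eta> =
     (\<Sum>m\<in>A. (max 0 (g m - cmod (h m) * sqrt (P m) / \<eta>))\<^sup>2) + \<sigma>\<^sup>2 / \<eta>\<^sup>2"

definition tau :: "('m \<Rightarrow> real) \<Rightarrow> ('m \<Rightarrow> complex) \<Rightarrow> ('m \<Rightarrow> real) \<Rightarrow> 'm \<Rightarrow> real" where
  "tau g h P m = cmod (h m) * sqrt (P m) / g m"

text \<open>In the following, \<open>s\<close> enumerates the index set on \<open>{1..card A}\<close> by
  nondecreasing threshold; ties may be broken in any way.\<close>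

definition threshold_order ::
  "'m set \<Rightarrow> ('m \<Rightarrow> real) \<Rightarrow> ('m \<Rightarrow> complex) \<Rightarrow> ('m \<Rightarrow> real) \<Rightarrow> (nat \<Rightarrow> 'm) \<Rightarrow> bool" where
  "threshold_order A g h P s \<longleftrightarrow>
     bij_betw s {1..card A} A \<and> mono_on {1..card A} (\<lambda>n. tau g h P (s n))"

definition tau_sorted ::
  "'m set \<Rightarrow> ('m \<Rightarrow> real) \<Rightarrow> ('m \<Rightarrow> complex) \<Rightarrow> ('m \<Rightarrow> real) \<Rightarrow> (nat \<Rightarrow> 'm) \<Rightarrow> nat \<Rightarrow> ereal" where
  "tau_sorted A g h P s n = (if n \<le> card A then ereal (tau g h P (s n)) else \<infinity>)"

definition eta_hat ::
  "('m \<Rightarrow> real) \<Rightarrow> ('m \<Rightarrow> complex) \<Rightarrow> ('m \<Rightarrow> real) \<Rightarrow> real \<Rightarrow> (nat \<Rightarrow> 'm) \<Rightarrow> nat \<Rightarrow> real" where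
  "eta_hat g h P \<sigma> s n =
     ((\<Sum>j=1..n. (cmod (h (s j)))\<^sup>2 * P (s j)) + \<sigma>\<^sup>2) /
     (\<Sum>j=1..n. cmod (h (s j)) * sqrt (P (s j)) * g (s j))"

text \<open>For \<open>1 \<le> n \<le> card A\<close> the clamped value is finite, so \<open>real_of_ereal\<close>
  loses nothing.\<close>

definition eta_star ::
  "'m set \<Rightarrow> ('m \<Rightarrow> real) \<Rightarrow> ('m \<Rightarrow> complex) \<Rightarrow> ('m \<Rightarrow> real) \<Rightarrow> real \<Rightarrow> (nat \<Rightarrow> 'm) \<Rightarrow> nat \<Rightarrow> real" where
  "eta_star A g h P \<sigma> s n = real_of_ereal
     (min (max (ereal (eta_hat g h P \<sigma> s n)) (tau_sorted A g h P s n))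
          (tau_sorted A g h P s (n + 1)))"

definition p_star ::
  "('m \<Rightarrow> real) \<Rightarrow> ('m \<Rightarrow> complex) \<Rightarrow> ('m \<Rightarrow> real) \<Rightarrow> real \<Rightarrow> 'm \<Rightarrow> real" where
  "p_star g h P \<eta> m = min ((\<eta> * g m / cmod (h m))\<^sup>2) (P m)"

end

theory Submission
  imports Defs
begin

text \<open>For a fixed \<open>\<eta>\<close> the problem decouples over \<open>m\<close>, and clipping the zero-forcing power at \<open>P m\<close>
  is optimal with value \<open>MSE \<eta>\<close>. Between two consecutive thresholds \<open>MSE\<close> is a convex quadratic in
  \<open>1 / \<eta>\<close> with vertex \<open>1 / eta_hat n\<close>, so on that segment it is minimised by the clamped vertex
  \<open>eta_star n\<close>; below the smallest threshold it equals \<open>\<sigma>\<^sup>2 / \<eta>\<^sup>2\<close>, which is decreasing. Hence the best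
  of the \<open>eta_star n\<close> is globally optimal.\<close>

text \<open>The right side minus the left side factors as
  \<open>(x - y) * (a * (x + y) - 2 * b)\<close>. With \<open>y\<close> between the vertex
  \<open>b / a\<close> and \<open>x\<close>, the two factors are both nonnegative or both
  nonpositive.\<close>

lemma quadratic_le_toward_vertex:
  fixes a b x y :: real
  assumes a: "0 < a" and between: "b / a \<le> y \<and> y \<le> x \<or> x \<le> y \<and> y \<le> b / a"
  shows "a * y\<^sup>2 - 2 * b * y \<le> a * x\<^sup>2 - 2 * b * x"
proof -
  have "0 \<le> (x - y) * (a * (x + y) - 2 * b)"
    using between
  proof
    assume *: "b / a \<le> y \<and> y \<le> x"
    then have "b \<le> a * y" "a * y \<le> a * x"
      using a by (simp_all add: pos_divide_le_eq mult.commute)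
    then show ?thesis using * by (intro mult_nonneg_nonneg) (simp_all add: algebra_simps)
  next
    assume *: "x \<le> y \<and> y \<le> b / a"
    then have "a * y \<le> b" "a * x \<le> a * y"
      using a by (simp_all add: pos_le_divide_eq mult.commute)
    then show ?thesis using * by (intro mult_nonpos_nonpos) (simp_all add: algebra_simps)
  qed
  then show ?thesis by (simp add: algebra_simps power2_eq_square)
qed

text \<open>The amplitude \<open>cmod (h m) * sqrt (p m) / \<eta>\<close> is largest at full power,
  so a shortfall from \<open>g m\<close> left there bounds the error of every feasible
  \<open>p m\<close> from below; without a shortfall the bound is 0.\<close>

lemma MSE_le_objective:
  assumes "feasible A P (p, \<eta>)"
  shows "MSE A g h P \<sigma> \<eta> \<le> objective A g h \<sigma> (p, \<eta>)"
proof -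
  have "(max 0 (g m - cmod (h m) * sqrt (P m) / \<eta>))\<^sup>2 \<le> (cmod (h m) * sqrt (p m) / \<eta> - g m)\<^sup>2"
    if "m \<in> A" for m
  proof -
    have "cmod (h m) * sqrt (p m) / \<eta> \<le> cmod (h m) * sqrt (P m) / \<eta>"
      using assms that by (intro divide_right_mono mult_left_mono) (auto simp: feasible_def)
    then have "max 0 (g m - cmod (h m) * sqrt (P m) / \<eta>) \<le> \<bar>cmod (h m) * sqrt (p m) / \<eta> - g m\<bar>"
      by linarith
    then show ?thesis by (metis max.cobounded1 power2_abs power_mono)
  qed
  then show ?thesis by (simp add: MSE_def objective_def sum_mono)
qed

lemma objective_p_star:
  assumes h: "\<And>m. m \<in> A \<Longrightarrow> h m \<noteq> 0" and g: "\<And>m. m \<in> A \<Longrightarrow> 0 < g m" and \<eta>: "0 < \<eta>"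
  shows "objective A g h \<sigma> (p_star g h P \<eta>, \<eta>) = MSE A g h P \<sigma> \<eta>"
proof -
  have "(cmod (h m) * sqrt (p_star g h P \<eta> m) / \<eta> - g m)\<^sup>2
      = (max 0 (g m - cmod (h m) * sqrt (P m) / \<eta>))\<^sup>2" if "m \<in> A" for m
  proof -
    \<comment> \<open>The zero-forcing amplitude: \<open>sqrt (p m) = z\<close> makes the error of
      this term vanish.\<close>
    define z where "z = \<eta> * g m / cmod (h m)"
    have hm: "0 < cmod (h m)" using h that by simp
    have z: "0 < z" using g[OF that] \<eta> hm by (simp add: z_def)
    have gz: "g m = cmod (h m) * z / \<eta>" using hm \<eta> by (simp add: z_def)
    have "sqrt (p_star g h P \<eta> m) = min z (sqrt (P m))"
      using z by (simp add: p_star_def z_def[symmetric] min_def real_le_rsqrt)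
        (smt (verit) real_sqrt_abs real_sqrt_le_iff)
    \<comment> \<open>The comparison that decides the \<open>min\<close> in the power thus also
      decides the \<open>max\<close> in \<open>MSE\<close>.\<close>
    moreover have "z \<le> sqrt (P m) \<longleftrightarrow> g m \<le> cmod (h m) * sqrt (P m) / \<eta>"
      unfolding gz using hm \<eta> by (simp add: divide_le_cancel)
    ultimately show ?thesis
      using gz by (auto simp: min_def max_def power2_commute)
  qed
  then show ?thesis by (simp add: MSE_def objective_def)
qed

lemma feasible_p_star:
  assumes "\<And>m. m \<in> A \<Longrightarrow> 0 < P m" and "0 < \<eta>"
  shows "feasible A P (p_star g h P \<eta>, \<eta>)"
  using assms by (auto simp: feasible_def p_star_def less_imp_le)

text \<open>Clamping is the projection onto the segment. The point \<open>\<eta>\<close> shows that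
  the segment is nonempty, so the projection lands in it, and it moves \<open>eta_hat\<close> toward
  \<open>\<eta>\<close> without passing it.\<close>

lemma eta_star_between:
  fixes \<sigma> :: real
  assumes n: "n \<le> card A"
    and lower: "tau g h P (s n) \<le> \<eta>"
    and upper: "ereal \<eta> \<le> tau_sorted A g h P s (n + 1)"
  defines "e \<equiv> eta_star A g h P \<sigma> s n"
  shows "eta_hat g h P \<sigma> s n \<le> e \<and> e \<le> \<eta> \<or> \<eta> \<le> e \<and> e \<le> eta_hat g h P \<sigma> s n"
    and "tau g h P (s n) \<le> e"
    and "ereal e \<le> tau_sorted A g h P s (n + 1)"
proof -
  have "(eta_hat g h P \<sigma> s n \<le> e \<and> e \<le> \<eta> \<or> \<eta> \<le> e \<and> e \<le> eta_hat g h P \<sigma> s n)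
      \<and> tau g h P (s n) \<le> e \<and> ereal e \<le> tau_sorted A g h P s (n + 1)"
  proof (cases "n + 1 \<le> card A")
    case True
    then have "e = min (max (eta_hat g h P \<sigma> s n) (tau g h P (s n))) (tau g h P (s (n + 1)))"
      using n by (simp add: e_def eta_star_def tau_sorted_def flip: ereal_max ereal_min)
    then show ?thesis using True lower upper by (auto simp: tau_sorted_def)
  next
    \<comment> \<open>The last segment is unbounded: its upper end is \<open>\<infinity>\<close>, so
      the outer \<open>min\<close> drops out.\<close>
    case False
    then have "e = max (eta_hat g h P \<sigma> s n) (tau g h P (s n))"
      using n by (simp add: e_def eta_star_def tau_sorted_def flip: ereal_max)
    then show ?thesis using False lower by (auto simp: tau_sorted_def)
  qed
  then show "eta_hat g h P \<sigma> s n \<le> e \<and> e \<le> \<eta> \<or> \<eta> \<le> e \<and> e \<le> eta_hat g h P \<sigma> s n"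
    and "tau g h P (s n) \<le> e" and "ereal e \<le> tau_sorted A g h P s (n + 1)"
    by auto
qed

lemma tau_sorted_step:
  assumes "threshold_order A g h P s" and "n \<in> {1..card A}"
  shows "ereal (tau g h P (s n)) \<le> tau_sorted A g h P s (n + 1)"
  using assms by (auto simp: threshold_order_def tau_sorted_def mono_on_def)

text \<open>On this segment the positive parts of \<open>s 1, ..., s n\<close> equal their arguments
  and all later ones vanish; expanding the squares gives a quadratic in \<open>1 / \<eta>\<close>.
  Both ends of the segment are included, since a positive part is 0 at its own threshold under
  either reading.\<close>

lemma MSE_quadratic:
  assumes g: "\<And>m. m \<in> A \<Longrightarrow> 0 < g m" and P: "\<And>m. m \<in> A \<Longrightarrow> 0 < P m"
    and s: "threshold_order A g h P s"
    and n: "n \<in> {1..card A}" and \<eta>: "0 < \<eta>"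
    and lower: "tau g h P (s n) \<le> \<eta>"
    and upper: "ereal \<eta> \<le> tau_sorted A g h P s (n + 1)"
  shows "MSE A g h P \<sigma> \<eta> =
    ((\<Sum>j=1..n. (cmod (h (s j)))\<^sup>2 * P (s j)) + \<sigma>\<^sup>2) * (1 / \<eta>)\<^sup>2
    - 2 * (\<Sum>j=1..n. cmod (h (s j)) * sqrt (P (s j)) * g (s j)) * (1 / \<eta>)
    + (\<Sum>j=1..n. (g (s j))\<^sup>2)"
proof -
  let ?f = "\<lambda>m. (max 0 (g m - cmod (h m) * sqrt (P m) / \<eta>))\<^sup>2"
  have bij: "bij_betw s {1..card A} A"
    and mono: "\<And>i j. i \<in> {1..card A} \<Longrightarrow> j \<in> {1..card A} \<Longrightarrow> i \<le> j \<Longrightarrow>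
        tau g h P (s i) \<le> tau g h P (s j)"
    using s by (auto simp: threshold_order_def mono_on_def)
  have sA: "s j \<in> A" if "j \<in> {1..card A}" for j
    using bij that by (rule bij_betw_apply)
  have unsaturated: "?f (s j) = 0" if j: "j \<in> {1..card A} - {1..n}" for j
  proof -
    have "n + 1 \<le> card A" using j by auto
    then have "\<eta> \<le> tau g h P (s (n + 1))" using upper by (simp add: tau_sorted_def)
    also have "\<dots> \<le> tau g h P (s j)" using j by (intro mono) auto
    finally show ?thesis
      using g[OF sA, of j] j \<eta> by (simp add: tau_def field_simps)
  qed
  have saturated: "?f (s j) = (cmod (h (s j)))\<^sup>2 * P (s j) * (1 / \<eta>)\<^sup>2
      - 2 * (cmod (h (s j)) * sqrt (P (s j)) * g (s j)) * (1 / \<eta>) + (g (s j))\<^sup>2"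
    if j: "j \<in> {1..n}" for j
  proof -
    have jA: "s j \<in> A" using j n by (intro sA) auto
    have "tau g h P (s j) \<le> \<eta>" using mono[of j n] j n lower by auto
    then have "0 \<le> g (s j) - cmod (h (s j)) * sqrt (P (s j)) / \<eta>"
      using g[OF jA] \<eta> by (simp add: tau_def field_simps)
    then have "?f (s j) = (g (s j) - cmod (h (s j)) * sqrt (P (s j)) / \<eta>)\<^sup>2"
      by simp
    also have "\<dots> = (cmod (h (s j)))\<^sup>2 * (sqrt (P (s j)))\<^sup>2 * (1 / \<eta>)\<^sup>2
      - 2 * (cmod (h (s j)) * sqrt (P (s j)) * g (s j)) * (1 / \<eta>) + (g (s j))\<^sup>2"
      by (simp add: power2_diff power_mult_distrib power_divide)
    finally show ?thesis using P[OF jA] by simp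
  qed
  have "(\<Sum>m\<in>A. ?f m) = (\<Sum>j\<in>{1..card A}. ?f (s j))"
    by (rule sum.reindex_bij_betw[OF bij, symmetric])
  also have "\<dots> = (\<Sum>j=1..n. ?f (s j))"
    using n unsaturated by (intro sum.mono_neutral_right) auto
  also have "\<dots> = (\<Sum>j=1..n. (cmod (h (s j)))\<^sup>2 * P (s j) * (1 / \<eta>)\<^sup>2
      - 2 * (cmod (h (s j)) * sqrt (P (s j)) * g (s j)) * (1 / \<eta>) + (g (s j))\<^sup>2)"
    using saturated by (rule sum.cong[OF refl])
  finally show ?thesis
    unfolding MSE_def
    by (simp add: sum.distrib sum_subtractf sum_distrib_right sum_distrib_left
        sum_divide_distrib power_divide add_divide_distrib)
qed

text \<open>In the variable \<open>1 / \<eta>\<close> the quadratic has vertex \<open>b / a\<close>,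
  the reciprocal of \<open>eta_hat\<close>, and clamping moves from \<open>\<eta>\<close> toward
  that vertex.\<close>

lemma MSE_eta_star_le:
  assumes g: "\<And>m. m \<in> A \<Longrightarrow> 0 < g m" and h: "\<And>m. m \<in> A \<Longrightarrow> h m \<noteq> 0"
    and P: "\<And>m. m \<in> A \<Longrightarrow> 0 < P m"
    and s: "threshold_order A g h P s"
    and n: "n \<in> {1..card A}"
    and lower: "tau g h P (s n) \<le> \<eta>"
    and upper: "ereal \<eta> \<le> tau_sorted A g h P s (n + 1)"
  shows "MSE A g h P \<sigma> (eta_star A g h P \<sigma> s n) \<le> MSE A g h P \<sigma> \<eta>"
proof -
  define e where "e = eta_star A g h P \<sigma> s n"
  define a where "a = (\<Sum>j=1..n. (cmod (h (s j)))\<^sup>2 * P (s j)) + \<sigma>\<^sup>2"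
  define b where "b = (\<Sum>j=1..n. cmod (h (s j)) * sqrt (P (s j)) * g (s j))"
  have sA: "s j \<in> A" if "j \<in> {1..n}" for j
    using s n that by (auto simp: threshold_order_def intro: bij_betw_apply)
  have "0 < (\<Sum>j=1..n. (cmod (h (s j)))\<^sup>2 * P (s j))"
    using n sA h P by (intro sum_pos) auto
  then have a: "0 < a" by (simp add: a_def add_pos_nonneg)
  have b: "0 < b"
    unfolding b_def using n sA h P g by (intro sum_pos) auto
  have hat: "eta_hat g h P \<sigma> s n = a / b" by (simp add: eta_hat_def a_def b_def)
  have "s n \<in> A" using n by (intro sA) auto
  then have tau_pos: "0 < tau g h P (s n)" using g h P by (simp add: tau_def)
  note e = eta_star_between[OF _ lower upper, where \<sigma> = \<sigma>, folded e_def, unfolded hat]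
  have e_low: "tau g h P (s n) \<le> e" and e_up: "ereal e \<le> tau_sorted A g h P s (n + 1)"
    and e_between: "a / b \<le> e \<and> e \<le> \<eta> \<or> \<eta> \<le> e \<and> e \<le> a / b"
    using e n by auto
  have pos: "0 < e" "0 < \<eta>" using tau_pos e_low lower by linarith+
  \<comment> \<open>Reciprocals of positive numbers reverse the order, so betweenness survives with
    its two cases exchanged.\<close>
  have "b / a \<le> 1 / e \<and> 1 / e \<le> 1 / \<eta> \<or> 1 / \<eta> \<le> 1 / e \<and> 1 / e \<le> b / a"
    using e_between pos a b by (auto simp: field_simps)
  \<comment> \<open>Both values of \<open>MSE\<close> come from the same quadratic, as
    \<open>e\<close> and \<open>\<eta>\<close> lie in one segment; the constant term
    cancels.\<close>
  from quadratic_le_toward_vertex[OF a this] show ?thesis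
    using MSE_quadratic[OF g P s n pos(1) e_low e_up, of \<sigma>]
      MSE_quadratic[OF g P s n pos(2) lower upper, of \<sigma>]
    by (simp add: e_def a_def b_def)
qed

text \<open>Up to \<open>\<theta>\<close> every positive part is 0, so only the noise term remains,
  and it does not increase with the factor.\<close>

lemma MSE_below_thresholds:
  assumes g: "\<And>m. m \<in> A \<Longrightarrow> 0 < g m" and \<eta>: "0 < \<eta>" and le: "\<eta> \<le> \<theta>"
    and \<theta>: "\<And>m. m \<in> A \<Longrightarrow> \<theta> \<le> tau g h P m"
  shows "MSE A g h P \<sigma> \<theta> \<le> MSE A g h P \<sigma> \<eta>"
proof -
  have "MSE A g h P \<sigma> x = \<sigma>\<^sup>2 / x\<^sup>2" if "0 < x" "x \<le> \<theta>" for x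
  proof -
    have "g m - cmod (h m) * sqrt (P m) / x \<le> 0" if "m \<in> A" for m
      using g[OF that] \<theta>[OF that] \<open>0 < x\<close> \<open>x \<le> \<theta>\<close>
      by (smt (verit) tau_def pos_le_divide_eq mult.commute)
    then have "(\<Sum>m\<in>A. (max 0 (g m - cmod (h m) * sqrt (P m) / x))\<^sup>2) = 0"
      by (intro sum.neutral) (simp add: max_absorb1)
    then show ?thesis by (simp add: MSE_def)
  qed
  moreover have "\<sigma>\<^sup>2 / \<theta>\<^sup>2 \<le> \<sigma>\<^sup>2 / \<eta>\<^sup>2"
    using \<eta> le by (intro divide_left_mono power_mono mult_pos_pos zero_less_power) auto
  ultimately show ?thesis using \<eta> le by simp
qed

text \<open>The segments between consecutive thresholds, together with the range below the first
  one, cover all positive factors.\<close>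

lemma exists_eta_star_le:
  assumes fin: "finite A" and ne: "A \<noteq> {}"
    and g: "\<And>m. m \<in> A \<Longrightarrow> 0 < g m" and h: "\<And>m. m \<in> A \<Longrightarrow> h m \<noteq> 0"
    and P: "\<And>m. m \<in> A \<Longrightarrow> 0 < P m"
    and s: "threshold_order A g h P s" and \<eta>: "0 < \<eta>"
  shows "\<exists>n\<in>{1..card A}. MSE A g h P \<sigma> (eta_star A g h P \<sigma> s n) \<le> MSE A g h P \<sigma> \<eta>"
proof (cases "tau g h P (s 1) \<le> \<eta>")
  case True
  define K where "K = {n \<in> {1..card A}. tau g h P (s n) \<le> \<eta>}"
  have card: "1 \<le> card A" using fin ne by (simp add: Suc_le_eq card_gt_0_iff)
  have K: "finite K" "K \<noteq> {}" using True card by (auto simp: K_def)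
  \<comment> \<open>Taking the last threshold not exceeding \<open>\<eta>\<close> also settles ties.
    That \<open>n + 1\<close> is not in \<open>K\<close> means that either the next threshold
    exceeds \<open>\<eta>\<close> or \<open>n\<close> is the last index and the upper end is
    infinite.\<close>
  define n where "n = Max K"
  have "n \<in> K" using K by (simp add: n_def)
  moreover have "n + 1 \<notin> K" using Max_ge[OF K(1), of "n + 1"] by (auto simp: n_def)
  ultimately have "n \<in> {1..card A}" "tau g h P (s n) \<le> \<eta>"
    "ereal \<eta> \<le> tau_sorted A g h P s (n + 1)"
    by (auto simp: K_def tau_sorted_def)
  then show ?thesis using MSE_eta_star_le[OF g h P s] by blast
next
  case False
  have 1: "1 \<in> {1..card A}" using fin ne by (simp add: Suc_le_eq card_gt_0_iff)
  have least: "tau g h P (s 1) \<le> tau g h P m" if "m \<in> A" for m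
  proof -
    obtain j where "j \<in> {1..card A}" "m = s j"
      using s \<open>m \<in> A\<close> unfolding threshold_order_def bij_betw_def by blast
    then show ?thesis
      using s 1 unfolding threshold_order_def mono_on_def by auto
  qed
  \<comment> \<open>Here \<open>\<eta>\<close> lies in no segment, so the comparison passes through
    the left end of the first one.\<close>
  have "MSE A g h P \<sigma> (eta_star A g h P \<sigma> s 1) \<le> MSE A g h P \<sigma> (tau g h P (s 1))"
    using tau_sorted_step[OF s 1] by (intro MSE_eta_star_le[OF g h P s 1]) auto
  also have "\<dots> \<le> MSE A g h P \<sigma> \<eta>"
    using False \<eta> least by (intro MSE_below_thresholds[OF g]) auto
  finally show ?thesis using 1 by blast
qed

theorem theorem1:
  fixes A :: "'m set"
    and g P :: "'m \<Rightarrow> real"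
    and h :: "'m \<Rightarrow> complex"
    and \<sigma> :: real
    and s :: "nat \<Rightarrow> 'm"
    and n_star :: nat
  assumes "finite A" and "A \<noteq> {}"
    and "\<And>m. m \<in> A \<Longrightarrow> g m > 0"
    and "\<And>m. m \<in> A \<Longrightarrow> h m \<noteq> 0"
    and "\<And>m. m \<in> A \<Longrightarrow> P m > 0"
    and "\<sigma>\<^sup>2 > 0"
    and "threshold_order A g h P s"
    and "is_arg_min (\<lambda>n. MSE A g h P \<sigma> (eta_star A g h P \<sigma> s n))
           (\<lambda>n. n \<in> {1..card A}) n_star"
  defines "\<eta> \<equiv> eta_star A g h P \<sigma> s n_star"
  shows "is_arg_min (objective A g h \<sigma>) (feasible A P) (p_star g h P \<eta>, \<eta>)"
proof -
  note g = assms(3) and h = assms(4) and P = assms(5) and s = assms(7)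
  have n: "n_star \<in> {1..card A}"
    and best: "\<And>n. n \<in> {1..card A} \<Longrightarrow>
      MSE A g h P \<sigma> \<eta> \<le> MSE A g h P \<sigma> (eta_star A g h P \<sigma> s n)"
    using assms(8) by (auto simp: is_arg_min_linorder \<eta>_def)
  have "s n_star \<in> A"
    using s n by (auto simp: threshold_order_def intro: bij_betw_apply)
  then have "0 < tau g h P (s n_star)" using g h P by (simp add: tau_def)
  \<comment> \<open>The left end of the segment serves as the point that
    \<open>eta_star_between\<close> asks for; the resulting positivity of \<open>\<eta>\<close>
    gives feasibility.\<close>
  also have "\<dots> \<le> \<eta>"
    unfolding \<eta>_def using n tau_sorted_step[OF s n] by (intro eta_star_between(2)) auto
  finally have \<eta>: "0 < \<eta>" .
  have "objective A g h \<sigma> (p_star g h P \<eta>, \<eta>) \<le> objective A g h \<sigma> (p, x)"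
    if feas: "feasible A P (p, x)" for p x
  proof -
    have "0 < x" using feas by (simp add: feasible_def)
    then obtain n where "n \<in> {1..card A}"
      "MSE A g h P \<sigma> (eta_star A g h P \<sigma> s n) \<le> MSE A g h P \<sigma> x"
      using exists_eta_star_le[OF assms(1,2) g h P s] by blast
    \<comment> \<open>The chain runs from \<open>MSE\<close> at \<open>\<eta>\<close> to the clamped
      vertex of index \<open>n\<close>, then to \<open>MSE\<close> at \<open>x\<close>, then to the
      objective at \<open>(p, x)\<close>.\<close>
    with best MSE_le_objective[OF feas, of g h \<sigma>]
    have "MSE A g h P \<sigma> \<eta> \<le> objective A g h \<sigma> (p, x)" by force
    then show ?thesis using objective_p_star[of A h g, OF h g \<eta>] by simp
  qed
  then show ?thesis
    using feasible_p_star[OF P \<eta>] by (auto simp: is_arg_min_linorder)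
qed

end
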